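(* Let $K$ be an oriented $n$-dimensional simplicial complex and let $G$ be a finite group acting on $K$ by simplicial isomorphisms. Then for every $k$ the discrete exterior derivative $d_k:\Omega_d^k(K)\to\Omega_d^{k+1}(K)$ is equivariant: $$d_k\circ\rho^k(g)=\rho^{k+1}(g)\circ d_k\qquad\text{for all } g\in G.$$
   Context: $K$ is an oriented $n$-dimensional simplicial complex (embedded in some $\mathbb{R}^N$). $C_k(K)$ is the real vector space of oriented $k$-chains, in which reversing the orientation of a simplex $\sigma$ gives $-\sigma$, and $\partial_k:C_k(K)\to C_{k-1}(K)$ is the usual simplicial boundary operator. A simplicial isomorphism $g:K\to K$ is a bijection on vertices mapping simplices to simplices and preserving incidence relations; it acts linearly on chains by $g[v_0,\dots,v_k]=[gv_0,\dots,gv_k]$ (with the sign convention above when orientations are reversed). Discrete $k$-forms: $\Omega_d^k(K):=\mathrm{Hom}(C_k(K),\mathbb{R})$, with pairing $\langle\alpha,\sigma\rangle:=\alpha(\sigma)$. Induced representation: $\rho^k:G\to \mathrm{GL}(\Omega_d^k(K))$ is defined by $\langle\rho^k(g)\alpha,\sigma\rangle:=\langle\alpha,g^{-1}\sigma\rangle$ for $\alpha\in\Omega_d^k(K)$, $\sigma\in C_k(K)$. Discrete exterior derivative: $d_k:\Omega_d^k(K)\to\Omega_d^{k+1}(K)$ is defined by $\langle d_k\alpha,\sigma\rangle:=\langle\alpha,\partial_{k+1}\sigma\rangle$ for $\alpha\in\Omega_d^k(K)$, $\sigma\in C_{k+1}(K)$. *)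

theory Defs
  imports
    "HOL-Analysis.Analysis"
    "HOL-Algebra.Group_Action"
    "HOL-Combinatorics.Permutations"
    "HOL-Library.Poly_Mapping"
begin

text \<open>Finitely supported functions as a real vector space, with pointwise operations.\<close>

instantiation poly_mapping :: (type, real_vector) real_vector
begin

lift_definition scaleR_poly_mapping :: "real \<Rightarrow> ('a \<Rightarrow>\<^sub>0 'b) \<Rightarrow> ('a \<Rightarrow>\<^sub>0 'b)"
  is "\<lambda>r f x. r *\<^sub>R f x"
  by (rule finite_subset[rotated]) auto

instance
  by standard (transfer; simp add: scaleR_add_right scaleR_add_left)+

end

section \<open>Oriented simplicial complexes\<close>

text \<open>
  The library predicate \<^const>\<open>simplicial_complex\<close> without the requirement that there are only
  finitely many simplices.  As in the library, simplices are closed convex sets, and the empty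
  set is the simplex of dimension \<open>-1\<close>.
\<close>

definition geometric_complex :: "'a::euclidean_space set set \<Rightarrow> bool" where
  "geometric_complex K \<longleftrightarrow>
     (\<forall>S\<in>K. \<exists>n. n simplex S) \<and>
     (\<forall>F S. S \<in> K \<and> F face_of S \<longrightarrow> F \<in> K) \<and>
     (\<forall>S S'. S \<in> K \<and> S' \<in> K \<longrightarrow> (S \<inter> S') face_of S)"

lemma simplicial_complex_iff: "simplicial_complex K \<longleftrightarrow> finite K \<and> geometric_complex K"
  by (simp add: simplicial_complex_def geometric_complex_def)

definition n_dimensional :: "nat \<Rightarrow> 'a::euclidean_space set set \<Rightarrow> bool" where
  "n_dimensional n K \<longleftrightarrow> (\<forall>S\<in>K. aff_dim S \<le> int n) \<and> (\<exists>S\<in>K. aff_dim S = int n)"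

definition vertices_of :: "'a::euclidean_space set \<Rightarrow> 'a set" where
  "vertices_of S = {v. v extreme_point_of S}"

definition vertex_set :: "'a::euclidean_space set set \<Rightarrow> 'a set" where
  "vertex_set K = {v. {v} \<in> K}"

definition simplices :: "'a::euclidean_space set set \<Rightarrow> nat \<Rightarrow> 'a set set" where
  "simplices K k = {S \<in> K. int k simplex S}"

text \<open>
  An orientation of \<open>K\<close> chooses for every simplex an ordering of its vertices.  The orientation of
  the simplex is the class of that ordering modulo even permutations.
\<close>

definition oriented_complex :: "'a::euclidean_space set set \<Rightarrow> ('a set \<Rightarrow> 'a list) \<Rightarrow> bool" where
  "oriented_complex K ori \<longleftrightarrow> geometric_complex K \<and>
     (\<forall>S\<in>K. distinct (ori S) \<and> set (ori S) = vertices_of S)"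

section \<open>Chains\<close>

text \<open>
  The real vector space of oriented \<open>k\<close>-chains has the \<open>k\<close>-simplices of \<open>K\<close>, each taken with its
  chosen orientation, as a basis: the basis vector of \<open>S\<close> is \<open>Poly_Mapping.single S 1\<close>.
\<close>

definition chains :: "'a::euclidean_space set set \<Rightarrow> nat \<Rightarrow> ('a set \<Rightarrow>\<^sub>0 real) set" where
  "chains K k = {c. Poly_Mapping.keys c \<subseteq> simplices K k}"

lemma subspace_chains: "subspace (chains K k)"
proof (rule subspaceI)
  show "0 \<in> chains K k" by (simp add: chains_def)
  show "x + y \<in> chains K k" if "x \<in> chains K k" "y \<in> chains K k" for x y
    using that Poly_Mapping.keys_add[of x y] by (auto simp: chains_def)
  show "r *\<^sub>R x \<in> chains K k" if "x \<in> chains K k" for r x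
  proof -
    have "Poly_Mapping.keys (r *\<^sub>R x) \<subseteq> Poly_Mapping.keys x"
      by (auto simp: in_keys_iff scaleR_poly_mapping.rep_eq)
    with that show ?thesis by (auto simp: chains_def)
  qed
qed

text \<open>
  The sign of the vertex permutation taking the ordering \<open>us\<close> to the ordering \<open>vs\<close> of the same
  vertices.
\<close>

definition ordering_sign :: "'a list \<Rightarrow> 'a list \<Rightarrow> real" where
  "ordering_sign us vs = real_of_int (sign (THE q. q permutes set us \<and> vs = map q us))"

lemma ordering_sign_map:
  assumes "distinct us" and "q permutes set us"
  shows "ordering_sign us (map q us) = real_of_int (sign q)"
proof -
  have "(THE p. p permutes set us \<and> map q us = map p us) = q"
  proof (rule the_equality)
    fix p assume p: "p permutes set us \<and> map q us = map p us"
    show "p = q"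
    proof
      fix x show "p x = q x"
        using p assms(2) by (cases "x \<in> set us") (auto simp: permutes_not_in)
    qed
  qed (use assms in auto)
  then show ?thesis by (simp add: ordering_sign_def)
qed

text \<open>
  The chain \<open>[v\<^sub>0, \<dots>, v\<^sub>k]\<close> given by an arbitrary ordering of the vertices of a simplex:
  the basis vector if the ordering induces the chosen orientation, minus it otherwise.
\<close>

definition oriented_simplex :: "('a::euclidean_space set \<Rightarrow> 'a list) \<Rightarrow> 'a list \<Rightarrow> ('a set \<Rightarrow>\<^sub>0 real)" where
  "oriented_simplex ori vs =
     (let S = convex hull (set vs) in Poly_Mapping.single S (ordering_sign (ori S) vs))"

lemma oriented_simplex_basis:
  assumes "distinct (ori S)" and "convex hull (set (ori S)) = S"
  shows "oriented_simplex ori (ori S) = Poly_Mapping.single S 1"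
  using ordering_sign_map[OF assms(1) permutes_id] assms(2)
  by (simp add: oriented_simplex_def sign_id)

lemma oriented_simplex_permute:
  assumes "distinct vs" and "q permutes set vs"
    and "distinct (ori (convex hull (set vs)))" and "set (ori (convex hull (set vs))) = set vs"
  shows "oriented_simplex ori (map q vs) = real_of_int (sign q) *\<^sub>R oriented_simplex ori vs"
proof -
  define us where "us = ori (convex hull (set vs))"
  have us: "distinct us" "set us = set vs" using assms(3,4) by (auto simp: us_def)
  have len: "length us = length vs" using us(2) distinct_card[OF us(1)] distinct_card[OF assms(1)] by simp
  obtain p where p: "p permutes set us" "vs = map p us"
  proof -
    have bij: "bij_betw (\<lambda>i. us ! i) {..<length us} (set us)"
      "bij_betw (\<lambda>i. vs ! i) {..<length us} (set us)"
      using us assms(1) len by (auto intro!: bij_betw_nth)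
    define h where "h = (\<lambda>x. vs ! (inv_into {..<length us} ((!) us) x))"
    have hb: "bij_betw h (set us) (set us)"
      unfolding h_def using bij_betw_trans[OF bij_betw_inv_into[OF bij(1)] bij(2)]
      by (simp add: comp_def)
    have hm: "vs = map h us"
      using bij(1) len
      by (intro nth_equalityI) (simp_all add: h_def bij_betw_def inv_into_f_f)
    have "(\<lambda>x. if x \<in> set us then h x else x) permutes set us"
    proof (rule bij_imp_permutes)
      show "bij_betw (\<lambda>x. if x \<in> set us then h x else x) (set us) (set us)"
        by (rule bij_betw_cong[THEN iffD1, OF _ hb]) simp
    qed simp
    moreover have "vs = map (\<lambda>x. if x \<in> set us then h x else x) us"
      by (subst hm) simp
    ultimately show thesis using that by blast
  qed
  have q: "q permutes set us" using assms(2) us by simp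
  have "ordering_sign us vs = real_of_int (sign p)"
    using ordering_sign_map[OF us(1) p(1)] p(2) by simp
  moreover have "ordering_sign us (map q vs) = real_of_int (sign (q \<circ> p))"
    using ordering_sign_map[OF us(1) permutes_compose[OF p(1) q]] p(2) by (simp add: comp_def)
  moreover have "sign (q \<circ> p) = sign q * sign p"
    using p(1) q by (intro sign_compose) (auto intro: permutes_imp_permutation)
  moreover have "set (map q vs) = set vs"
    using assms(2) by (simp add: permutes_image)
  ultimately show ?thesis
    by (intro poly_mapping_eqI)
      (simp add: oriented_simplex_def Let_def scaleR_poly_mapping.rep_eq lookup_single when_def
        flip: us_def)
qed

text \<open>
  Both the boundary operator and the action of a vertex map on chains are the linear extensions of
  the formulas \<open>\<partial>[v\<^sub>0, \<dots>, v\<^sub>k] = (\<Sum>i\<le>k. (-1)\<^sup>i [v\<^sub>0, \<dots>, v\<^sub>i omitted, \<dots>, v\<^sub>k])\<close> and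
  \<open>f[v\<^sub>0, \<dots>, v\<^sub>k] = [f v\<^sub>0, \<dots>, f v\<^sub>k]\<close> from the basis of positively oriented simplices.
  The boundary of a \<open>0\<close>-chain is \<open>0\<close>.
\<close>

definition boundary ::
  "('a::euclidean_space set \<Rightarrow> 'a list) \<Rightarrow> nat \<Rightarrow> ('a set \<Rightarrow>\<^sub>0 real) \<Rightarrow> ('a set \<Rightarrow>\<^sub>0 real)" where
  "boundary ori k c = (if k = 0 then 0 else
     (\<Sum>S\<in>Poly_Mapping.keys c. Poly_Mapping.lookup c S *\<^sub>R
        (\<Sum>i\<le>k. (-1) ^ i *\<^sub>R oriented_simplex ori (take i (ori S) @ drop (Suc i) (ori S)))))"

definition chain_map ::
  "('a::euclidean_space set \<Rightarrow> 'a list) \<Rightarrow> ('a \<Rightarrow> 'a) \<Rightarrow> ('a set \<Rightarrow>\<^sub>0 real) \<Rightarrow> ('a set \<Rightarrow>\<^sub>0 real)" where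
  "chain_map ori f c =
     (\<Sum>S\<in>Poly_Mapping.keys c. Poly_Mapping.lookup c S *\<^sub>R oriented_simplex ori (map f (ori S)))"

section \<open>Simplicial group actions\<close>

definition simplex_image :: "('a \<Rightarrow> 'a) \<Rightarrow> 'a::euclidean_space set \<Rightarrow> 'a set" where
  "simplex_image f S = convex hull (f ` vertices_of S)"

text \<open>
  Incidence is the face relation.  The vertices of \<open>simplex_image f S \<in> K\<close> are exactly the points
  of \<open>f ` vertices_of S\<close>: a vertex of the complex \<open>K\<close> lying in a simplex of \<open>K\<close> is an extreme point
  of it.
\<close>

definition simplicial_isomorphism :: "'a::euclidean_space set set \<Rightarrow> ('a \<Rightarrow> 'a) \<Rightarrow> bool" where
  "simplicial_isomorphism K f \<longleftrightarrow>
     bij_betw f (vertex_set K) (vertex_set K) \<and>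
     (\<forall>S\<in>K. simplex_image f S \<in> K) \<and>
     (\<forall>S\<in>K. \<forall>T\<in>K. T face_of S \<longleftrightarrow> simplex_image f T face_of simplex_image f S)"

definition acts_simplicially ::
  "('g, 'b) monoid_scheme \<Rightarrow> 'a::euclidean_space set set \<Rightarrow> ('g \<Rightarrow> 'a \<Rightarrow> 'a) \<Rightarrow> bool" where
  "acts_simplicially G K \<phi> \<longleftrightarrow>
     group_action G (vertex_set K) \<phi> \<and> (\<forall>g\<in>carrier G. simplicial_isomorphism K (\<phi> g))"

section \<open>Discrete forms\<close>

text \<open>
  Linear functionals on the subspace of \<open>k\<close>-chains.  They are \<^const>\<open>extensional\<close>, so that forms
  agreeing on all \<open>k\<close>-chains are equal.
\<close>

definition discrete_forms :: "'a::euclidean_space set set \<Rightarrow> nat \<Rightarrow> (('a set \<Rightarrow>\<^sub>0 real) \<Rightarrow> real) set" where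
  "discrete_forms K k = {\<alpha> \<in> extensional (chains K k).
     (\<forall>c\<in>chains K k. \<forall>c'\<in>chains K k. \<alpha> (c + c') = \<alpha> c + \<alpha> c') \<and>
     (\<forall>r. \<forall>c\<in>chains K k. \<alpha> (r *\<^sub>R c) = r * \<alpha> c)}"

definition form_rep ::
  "'a::euclidean_space set set \<Rightarrow> ('a set \<Rightarrow> 'a list) \<Rightarrow> ('g, 'b) monoid_scheme \<Rightarrow> ('g \<Rightarrow> 'a \<Rightarrow> 'a) \<Rightarrow>
   nat \<Rightarrow> 'g \<Rightarrow> (('a set \<Rightarrow>\<^sub>0 real) \<Rightarrow> real) \<Rightarrow> (('a set \<Rightarrow>\<^sub>0 real) \<Rightarrow> real)" where
  "form_rep K ori G \<phi> k g =
     (\<lambda>\<alpha>\<in>discrete_forms K k. \<lambda>c\<in>chains K k. \<alpha> (chain_map ori (\<phi> (inv\<^bsub>G\<^esub> g)) c))"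

definition ext_deriv ::
  "'a::euclidean_space set set \<Rightarrow> ('a set \<Rightarrow> 'a list) \<Rightarrow>
   nat \<Rightarrow> (('a set \<Rightarrow>\<^sub>0 real) \<Rightarrow> real) \<Rightarrow> (('a set \<Rightarrow>\<^sub>0 real) \<Rightarrow> real)" where
  "ext_deriv K ori k =
     (\<lambda>\<alpha>\<in>discrete_forms K k. \<lambda>c\<in>chains K (k + 1). \<alpha> (boundary ori (k + 1) c))"

end

theory Submission
  imports Defs
begin

text \<open>
  By duality the claim reduces to chains: \<open>d\<close> and \<open>\<rho>(g)\<close> are precomposition with the boundary
  operator and with the chain map of \<open>g\<^sup>-\<^sup>1\<close>, so they commute as soon as
  \<open>\<partial> (f c) = f (\<partial> c)\<close> for every chain \<open>c\<close> and every simplicial isomorphism \<open>f\<close>.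

  Writing \<open>[v\<^sub>0, \<dots>, v\<^sub>k]\<close> for an oriented simplex, this identity is evident if
  \<open>\<partial>[v\<^sub>0, \<dots>, v\<^sub>k] = (\<Sum>i. (-1)\<^sup>i [\<dots>, v\<^sub>i omitted, \<dots>])\<close> and
  \<open>f[v\<^sub>0, \<dots>, v\<^sub>k] = [f v\<^sub>0, \<dots>, f v\<^sub>k]\<close> hold for all orderings of the vertices, because omitting
  an entry of a list commutes with mapping \<open>f\<close> over it. Both operators are, however, specified by
  these formulas only on the chosen ordering of each simplex, and \<open>f\<close> does not respect the choices.
  What has to be shown is therefore that the right-hand sides are alternating in
  \<open>v\<^sub>0, \<dots>, v\<^sub>k\<close>, as the left-hand sides are; adjacent transpositions suffice for this
  (\<open>alternating_on_ordering_sign\<close>). For the boundary formula, an adjacent transposition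
  exchanges the two terms that omit one of the transposed vertices, whose signs are opposite, and
  transposes two vertices in every other term (\<open>alternating_on_boundary_sum\<close>).

  The geometric input is that \<open>f\<close> carries the vertices of a simplex bijectively onto those of its
  image (\<open>simplex_vertices_image\<close>), so that no degenerate simplices arise.
\<close>

section \<open>Alternating functions of orderings\<close>

definition alternating_on :: "'a set \<Rightarrow> ('a list \<Rightarrow> 'b::real_vector) \<Rightarrow> bool" where
  "alternating_on V F \<longleftrightarrow>
     (\<forall>xs x y zs. distinct (xs @ x # y # zs) \<longrightarrow> set (xs @ x # y # zs) = V \<longrightarrow>
        F (xs @ y # x # zs) = - F (xs @ x # y # zs))"

lemma alternating_onD:
  assumes "alternating_on V F" "distinct (xs @ x # y # zs)" "set (xs @ x # y # zs) = V"
  shows "F (xs @ y # x # zs) = - F (xs @ x # y # zs)"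
  using assms unfolding alternating_on_def by blast

lemma alternating_on_move:
  assumes "alternating_on V F" "distinct (xs @ x # ms @ zs)" "set (xs @ x # ms @ zs) = V"
  shows "F (xs @ ms @ x # zs) = (-1) ^ length ms *\<^sub>R F (xs @ x # ms @ zs)"
  using assms(2,3)
proof (induction ms arbitrary: xs)
  case Nil
  then show ?case by simp
next
  case (Cons m ms)
  have "F ((xs @ [m]) @ ms @ x # zs) = (-1) ^ length ms *\<^sub>R F ((xs @ [m]) @ x # ms @ zs)"
    by (rule Cons.IH) (use Cons.prems in \<open>auto simp: insert_commute\<close>)
  moreover have "F (xs @ m # x # ms @ zs) = - F (xs @ x # m # ms @ zs)"
    by (rule alternating_onD[OF assms(1)]) (use Cons.prems in \<open>auto simp: insert_commute\<close>)
  ultimately show ?case by simp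
qed

text \<open>
  Moving \<open>x\<close> right past \<open>ms\<close> and \<open>y\<close>, then \<open>y\<close> left past \<open>ms\<close>, takes \<open>2 * length ms + 1\<close> adjacent
  transpositions, an odd number.
\<close>

lemma alternating_on_swap:
  assumes "alternating_on V F" "distinct (xs @ x # ms @ y # zs)" "set (xs @ x # ms @ y # zs) = V"
  shows "F (xs @ y # ms @ x # zs) = - F (xs @ x # ms @ y # zs)"
proof -
  have "F (xs @ ms @ x # y # zs) = (-1) ^ length ms *\<^sub>R F (xs @ x # ms @ y # zs)"
    by (rule alternating_on_move[OF assms(1)]) (use assms(2,3) in \<open>auto simp: insert_commute\<close>)
  moreover have "F ((xs @ ms) @ y # x # zs) = - F ((xs @ ms) @ x # y # zs)"
    by (rule alternating_onD[OF assms(1)]) (use assms(2,3) in \<open>auto simp: insert_commute\<close>)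
  moreover have "F (xs @ ms @ y # x # zs) = (-1) ^ length ms *\<^sub>R F (xs @ y # ms @ x # zs)"
    by (rule alternating_on_move[OF assms(1)]) (use assms(2,3) in \<open>auto simp: insert_commute\<close>)
  ultimately have "(-1::real) ^ length ms *\<^sub>R F (xs @ y # ms @ x # zs) =
      (-1::real) ^ length ms *\<^sub>R (- F (xs @ x # ms @ y # zs))"
    by simp
  then show ?thesis by (subst (asm) scaleR_cancel_left) simp
qed

lemma map_transpose_distinct:
  assumes "distinct (xs @ x # ms @ y # zs)"
  shows "map (Transposition.transpose x y) (xs @ x # ms @ y # zs) = xs @ y # ms @ x # zs"
proof -
  have "map (Transposition.transpose x y) l = l" if "x \<notin> set l" "y \<notin> set l" for l
    using that by (intro map_idI) (metis transpose_apply_other)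
  with assms show ?thesis by simp
qed

lemma alternating_on_transpose:
  assumes F: "alternating_on V F" and vs: "distinct vs" "set vs = V"
    and xy: "x \<in> V" "y \<in> V" "x \<noteq> y"
  shows "F (map (Transposition.transpose x y) vs) = - F vs"
proof -
  have *: "F (map (Transposition.transpose a b) vs) = - F vs"
    if "vs = xs @ a # ms @ b # zs" for a b xs ms zs
    using alternating_on_swap[OF F, of xs a ms b zs] map_transpose_distinct[of xs a ms b zs] vs that
    by simp
  obtain xs zs where split: "vs = xs @ x # zs"
    using xy vs by (meson split_list)
  consider "y \<in> set zs" | "y \<in> set xs"
    using xy vs split by auto
  then show ?thesis
  proof cases
    case 1
    then show ?thesis
      using * split by (metis split_list)
  next
    case 2
    then obtain as bs where "xs = as @ y # bs"
      by (meson split_list)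
    then show ?thesis
      using *[of as y bs x zs] split by (simp add: transpose_commute)
  qed
qed

lemma obtain_permutes_map:
  assumes "distinct us" "distinct vs" "set us = set vs"
  obtains q where "q permutes set us" "vs = map q us"
proof -
  define q where "q x = (if x \<in> set us then the (map_of (zip us vs) x) else x)" for x
  have len: "length us = length vs"
    using assms by (metis distinct_card)
  have map: "vs = map q us"
    using len assms(1) by (intro nth_equalityI) (simp_all add: q_def map_of_zip_nth)
  then have "q ` set us = set us"
    using assms(3) by (metis set_map)
  then have "bij_betw q (set us) (set us)"
    by (simp add: bij_betw_def eq_card_imp_inj_on)
  then have "q permutes set us"
    by (rule bij_imp_permutes) (simp add: q_def)
  then show thesis using map that by blast
qed

text \<open>
  Transpositions generate all permutations, so an alternating function is determined by its value
  on one ordering.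
\<close>

lemma alternating_on_ordering_sign:
  assumes F: "alternating_on V F" and us: "distinct us" "set us = V" and vs: "distinct vs" "set vs = V"
  shows "F vs = ordering_sign us vs *\<^sub>R F us"
proof -
  obtain q where q: "q permutes V" "vs = map q us"
    using obtain_permutes_map[OF us(1) vs(1)] us vs by auto
  have fin: "finite V" using us by auto
  have "F (map q us) = real_of_int (sign q) *\<^sub>R F us"
    using q(1) fin
  proof (induction rule: permutes_induct)
    case id
    then show ?case by (simp add: sign_id)
  next
    case (swap a b p)
    have "distinct (map p us)" "set (map p us) = V"
      using swap us by (auto simp: distinct_map permutes_inj_on permutes_image)
    then have "F (map (Transposition.transpose a b) (map p us)) = - F (map p us)"
      using swap by (intro alternating_on_transpose[OF F]) auto
    moreover have "sign (Transposition.transpose a b \<circ> p) = - sign p"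
      using swap fin by (subst sign_compose)
        (auto simp: sign_swap_id permutation_swap_id intro: permutes_imp_permutation)
    ultimately show ?case
      using swap.IH by (simp only: map_map of_int_minus scaleR_minus_left)
  qed
  with q us show ?thesis by (simp add: ordering_sign_map)
qed

section \<open>Vertices of simplices\<close>

definition simplex_vertices :: "'a::euclidean_space set set \<Rightarrow> 'a set \<Rightarrow> bool" where
  "simplex_vertices K V \<longleftrightarrow> \<not> affine_dependent V \<and> convex hull V \<in> K"

lemma vertices_of_convex_hull:
  assumes "\<not> affine_dependent V"
  shows "vertices_of (convex hull V) = V"
  using assms by (simp add: vertices_of_def extreme_point_of_convex_hull_affine_independent)

lemma simplex_vertices_subset:
  assumes "geometric_complex K" "simplex_vertices K V" "W \<subseteq> V"
  shows "simplex_vertices K W"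
proof -
  have "convex hull W face_of convex hull V"
    using assms by (auto simp: simplex_vertices_def face_of_convex_hull_affine_independent)
  with assms show ?thesis
    unfolding geometric_complex_def simplex_vertices_def
    by (meson affine_dependent_subset)
qed

lemma simplex_vertices_imp_vertex_set:
  assumes "geometric_complex K" "simplex_vertices K V"
  shows "V \<subseteq> vertex_set K"
proof
  fix v assume "v \<in> V"
  then have "simplex_vertices K {v}"
    by (intro simplex_vertices_subset[OF assms]) simp
  then show "v \<in> vertex_set K"
    by (simp add: simplex_vertices_def vertex_set_def)
qed

lemma obtain_simplex_vertices:
  assumes "geometric_complex K" "S \<in> K"
  obtains V where "simplex_vertices K V" "S = convex hull V"
proof -
  from assms obtain n where "n simplex S"
    unfolding geometric_complex_def by blast
  then obtain V where "\<not> affine_dependent V" "S = convex hull V"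
    unfolding simplex_def by blast
  with assms(2) that show thesis by (simp add: simplex_vertices_def)
qed

lemma convex_hull_in_simplices:
  assumes "simplex_vertices K V" "card V = Suc k"
  shows "convex hull V \<in> simplices K k"
  using assms unfolding simplices_def simplex_def simplex_vertices_def by auto

lemma
  assumes "oriented_complex K ori" "simplex_vertices K V"
  shows distinct_orientation: "distinct (ori (convex hull V))"
    and set_orientation: "set (ori (convex hull V)) = V"
  using assms vertices_of_convex_hull
  by (auto simp: oriented_complex_def simplex_vertices_def)

lemma orientation_of_simplex:
  assumes "oriented_complex K ori" "S \<in> simplices K k"
  shows "distinct (ori S)" "simplex_vertices K (set (ori S))"
    "convex hull (set (ori S)) = S" "length (ori S) = Suc k"
proof -
  from assms(2) obtain V where V: "\<not> affine_dependent V" "card V = Suc k" "S = convex hull V" "S \<in> K"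
    by (auto simp: simplices_def simplex_def)
  then have "simplex_vertices K V" by (simp add: simplex_vertices_def)
  note ori = distinct_orientation[OF assms(1) this] set_orientation[OF assms(1) this]
  show "distinct (ori S)" "simplex_vertices K (set (ori S))" "convex hull (set (ori S)) = S"
    using ori V by (auto simp: simplex_vertices_def)
  show "length (ori S) = Suc k"
    using ori V distinct_card by metis
qed

lemma simplicial_isomorphism_inj_on:
  assumes "geometric_complex K" "simplicial_isomorphism K f" "simplex_vertices K V"
  shows "inj_on f V"
  using assms simplex_vertices_imp_vertex_set
  by (meson bij_betw_imp_inj_on inj_on_subset simplicial_isomorphism_def)

text \<open>
  The image \<open>convex hull (f ` V)\<close> is a simplex of \<open>K\<close>, hence the hull of an affinely independent
  set \<open>C\<close> consisting of its extreme points. Extreme points of a hull are among the spanning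
  points, so \<open>C \<subseteq> f ` V\<close>. Conversely each \<open>f v\<close> is itself a simplex of \<open>K\<close>, and as two simplices
  of \<open>K\<close> meet in a common face, it is an extreme point of the image.
\<close>

lemma simplex_vertices_image:
  assumes K: "geometric_complex K" and f: "simplicial_isomorphism K f" and V: "simplex_vertices K V"
  shows "simplex_vertices K (f ` V)"
proof -
  define T where "T = convex hull (f ` V)"
  have "simplex_image f (convex hull V) = T"
    using V by (simp add: simplex_image_def T_def vertices_of_convex_hull simplex_vertices_def)
  then have T: "T \<in> K"
    using f V by (auto simp: simplicial_isomorphism_def simplex_vertices_def)
  then obtain C where C: "simplex_vertices K C" "T = convex hull C"
    using obtain_simplex_vertices[OF K] by blast
  have "C = vertices_of T"
    using C by (simp add: vertices_of_convex_hull simplex_vertices_def)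
  also have "\<dots> = f ` V"
  proof
    show "vertices_of T \<subseteq> f ` V"
      unfolding vertices_of_def T_def using extreme_point_of_convex_hull by blast
    show "f ` V \<subseteq> vertices_of T"
    proof
      fix w assume w: "w \<in> f ` V"
      then have "w \<in> vertex_set K"
        using simplex_vertices_imp_vertex_set[OF K V] f
        by (auto simp: simplicial_isomorphism_def bij_betw_def)
      then have "{w} \<in> K" by (simp add: vertex_set_def)
      with T K have "T \<inter> {w} face_of T" by (simp add: geometric_complex_def)
      moreover have "w \<in> T" unfolding T_def using w by (rule hull_inc)
      ultimately show "w \<in> vertices_of T"
        by (simp add: vertices_of_def face_of_singleton Int_absorb1)
    qed
  qed
  finally show ?thesis using C by simp
qed

section \<open>Oriented simplices and their boundaries as alternating functions\<close>

lemma alternating_on_oriented_simplex: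
  assumes "oriented_complex K ori" "simplex_vertices K V"
  shows "alternating_on V (oriented_simplex ori)"
  unfolding alternating_on_def
proof (intro allI impI)
  fix xs x y zs
  assume vs: "distinct (xs @ x # y # zs)" "set (xs @ x # y # zs) = V"
  define us where "us = xs @ x # y # zs"
  have us: "distinct us" "set us = V" and xy: "x \<in> V" "y \<in> V" "x \<noteq> y"
    using vs(1) by (auto simp: us_def vs(2)[symmetric])
  have "oriented_simplex ori (map (Transposition.transpose x y) us) =
      real_of_int (sign (Transposition.transpose x y)) *\<^sub>R oriented_simplex ori us"
    by (rule oriented_simplex_permute)
      (simp_all only: us permutes_swap_id[OF xy(1,2)] distinct_orientation[OF assms]
        set_orientation[OF assms])
  also have "map (Transposition.transpose x y) us = xs @ y # x # zs"
    using map_transpose_distinct[of xs x "[]" y zs] vs(1) by (simp add: us_def)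
  finally show "oriented_simplex ori (xs @ y # x # zs) = - oriented_simplex ori (xs @ x # y # zs)"
    using xy(3) by (simp add: sign_swap_id us_def)
qed

lemma alternating_on_map:
  assumes F: "alternating_on (f ` V) F" and f: "inj_on f V"
  shows "alternating_on V (\<lambda>vs. F (map f vs))"
  unfolding alternating_on_def
proof (intro allI impI)
  fix xs x y zs
  assume vs: "distinct (xs @ x # y # zs)" "set (xs @ x # y # zs) = V"
  have "distinct (map f (xs @ x # y # zs))"
    unfolding distinct_map using vs f by simp
  moreover have "set (map f (xs @ x # y # zs)) = f ` V"
    by (simp only: set_map vs(2))
  ultimately show "F (map f (xs @ y # x # zs)) = - F (map f (xs @ x # y # zs))"
    using alternating_onD[OF F, of "map f xs" "f x" "f y" "map f zs"] by simp
qed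

definition omit :: "nat \<Rightarrow> 'a list \<Rightarrow> 'a list" where
  "omit i vs = take i vs @ drop (Suc i) vs"

lemma omit_map: "omit i (map f vs) = map f (omit i vs)"
  by (simp add: omit_def take_map drop_map)

lemma length_omit: "i < length vs \<Longrightarrow> length (omit i vs) = length vs - 1"
  by (simp add: omit_def)

lemma set_omit_subset: "set (omit i vs) \<subseteq> set vs"
  using set_take_subset set_drop_subset by (fastforce simp: omit_def)

lemma distinct_omit: "distinct vs \<Longrightarrow> distinct (omit i vs)"
  unfolding omit_def
  by (auto simp: set_take_disj_set_drop_if_distinct)

lemma simplex_vertices_omit:
  assumes "oriented_complex K ori" "simplex_vertices K (set vs)"
  shows "simplex_vertices K (set (omit i vs))"
proof (rule simplex_vertices_subset[OF _ assms(2) set_omit_subset])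
  show "geometric_complex K" using assms(1) by (simp add: oriented_complex_def)
qed

definition boundary_sum ::
  "('a::euclidean_space set \<Rightarrow> 'a list) \<Rightarrow> 'a list \<Rightarrow> ('a set \<Rightarrow>\<^sub>0 real)" where
  "boundary_sum ori vs = (\<Sum>i<length vs. (-1) ^ i *\<^sub>R oriented_simplex ori (omit i vs))"

text \<open>
  Transposing positions \<open>n\<close> and \<open>n + 1\<close> of the list is matched by transposing the summation
  indices \<open>n\<close> and \<open>n + 1\<close>. After this reindexing the sums agree up to sign term by term: for these
  two indices the omitted lists coincide and \<open>(-1)\<^sup>i\<close> changes sign; for every other index the
  omitted list undergoes an adjacent transposition.
\<close>

lemma alternating_on_boundary_sum:
  assumes ori: "oriented_complex K ori" and V: "simplex_vertices K V"
  shows "alternating_on V (boundary_sum ori)"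
  unfolding alternating_on_def
proof (intro allI impI)
  fix xs x y zs
  assume vs: "distinct (xs @ x # y # zs)" "set (xs @ x # y # zs) = V"
  define us where "us = xs @ x # y # zs"
  define ws where "ws = xs @ y # x # zs"
  define n where "n = length xs"
  define \<tau> where "\<tau> = Transposition.transpose n (Suc n)"
  let ?t = "\<lambda>us i. (-1) ^ i *\<^sub>R oriented_simplex ori (omit i us)"
  have len: "length ws = length us" "Suc n < length us"
    by (simp_all add: us_def ws_def n_def)
  have swap_terms: "?t ws (\<tau> i) = - ?t us i" if "i < length us" for i
  proof -
    consider "i = n" | "i = Suc n" | "i \<noteq> n" "i \<noteq> Suc n" by blast
    then show ?thesis
    proof cases
      case 1
      then have "omit (\<tau> i) ws = omit i us"
        by (simp add: \<tau>_def omit_def us_def ws_def n_def)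
      with 1 show ?thesis by (simp add: \<tau>_def)
    next
      case 2
      then have "omit (\<tau> i) ws = omit i us"
        by (simp add: \<tau>_def omit_def us_def ws_def n_def)
      with 2 show ?thesis by (simp add: \<tau>_def)
    next
      case 3
      then have \<tau>: "\<tau> i = i" by (simp add: \<tau>_def)
      obtain as bs where split: "omit i us = as @ x # y # bs" "omit i ws = as @ y # x # bs"
      proof (cases "i < n")
        case True
        then show thesis
          using that[of "omit i xs" zs] by (simp add: omit_def us_def ws_def n_def)
      next
        case False
        with 3 obtain j where "i = Suc (Suc (n + j))"
          by (metis add_Suc_right less_natE linorder_neqE_nat not_less_eq)
        then show thesis
          using that[of xs "omit j zs"]
            by (simp add: omit_def us_def ws_def n_def eval_nat_numeral)
      qed
      have "simplex_vertices K (set (omit i us))"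
        by (rule simplex_vertices_omit[OF ori]) (simp only: us_def vs(2) V)
      then have "alternating_on (set (omit i us)) (oriented_simplex ori)"
        by (rule alternating_on_oriented_simplex[OF ori])
      moreover have "distinct (omit i us)"
        using vs(1) unfolding us_def by (rule distinct_omit)
      ultimately have "oriented_simplex ori (omit i ws) = - oriented_simplex ori (omit i us)"
        unfolding split by (rule alternating_onD[OF _ _ refl])
      with \<tau> show ?thesis by simp
    qed
  qed
  have "\<tau> permutes {..<length us}"
    unfolding \<tau>_def using len(2) by (intro permutes_swap_id) auto
  then have "boundary_sum ori ws = (\<Sum>i<length us. ?t ws (\<tau> i))"
    unfolding boundary_sum_def len(1) by (subst sum.permute) (simp_all add: comp_def)
  also have "\<dots> = (\<Sum>i<length us. - ?t us i)"
    by (intro sum.cong refl swap_terms) simp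
  also have "\<dots> = - boundary_sum ori us"
    by (simp add: boundary_sum_def sum_negf)
  finally show "boundary_sum ori (xs @ y # x # zs) = - boundary_sum ori (xs @ x # y # zs)"
    by (simp add: us_def ws_def)
qed

section \<open>Chain maps and the boundary operator\<close>

definition linear_extension ::
  "('i \<Rightarrow> 'b::real_vector) \<Rightarrow> ('i \<Rightarrow>\<^sub>0 real) \<Rightarrow> 'b" where
  "linear_extension F c =
     (\<Sum>S\<in>Poly_Mapping.keys c. Poly_Mapping.lookup c S *\<^sub>R F S)"

lemma linear_extension_superset:
  assumes "finite A" "Poly_Mapping.keys c \<subseteq> A"
  shows "linear_extension F c = (\<Sum>S\<in>A. Poly_Mapping.lookup c S *\<^sub>R F S)"
  unfolding linear_extension_def
  using assms by (intro sum.mono_neutral_left) (auto simp: in_keys_iff)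

lemma linear_linear_extension: "linear (linear_extension F)"
proof (rule linearI)
  fix c c' :: "'a \<Rightarrow>\<^sub>0 real" and r :: real
  let ?A = "Poly_Mapping.keys c \<union> Poly_Mapping.keys c'"
  have "linear_extension F (c + c') = (\<Sum>S\<in>?A. Poly_Mapping.lookup (c + c') S *\<^sub>R F S)"
    by (rule linear_extension_superset) (auto dest: subsetD[OF Poly_Mapping.keys_add])
  also have "\<dots> = linear_extension F c + linear_extension F c'"
    by (simp add: linear_extension_superset[of ?A] lookup_add scaleR_add_left sum.distrib)
  finally show "linear_extension F (c + c') = linear_extension F c + linear_extension F c'" .
  have "linear_extension F (r *\<^sub>R c) =
      (\<Sum>S\<in>Poly_Mapping.keys c. Poly_Mapping.lookup (r *\<^sub>R c) S *\<^sub>R F S)"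
    by (rule linear_extension_superset) (auto simp: in_keys_iff scaleR_poly_mapping.rep_eq)
  then show "linear_extension F (r *\<^sub>R c) = r *\<^sub>R linear_extension F c"
    by (simp add: linear_extension_def scaleR_poly_mapping.rep_eq scaleR_sum_right)
qed

lemma linear_extension_single: "linear_extension F (Poly_Mapping.single S r) = r *\<^sub>R F S"
  by (subst linear_extension_superset[of "{S}"]) auto

lemma linear_extension_in_subspace:
  assumes "subspace U" "\<And>S. S \<in> Poly_Mapping.keys c \<Longrightarrow> F S \<in> U"
  shows "linear_extension F c \<in> U"
  unfolding linear_extension_def using assms by (intro subspace_sum subspace_scale)

lemma linear_linear_extension_comp:
  assumes "linear L"
  shows "L (linear_extension F c) = linear_extension (\<lambda>S. L (F S)) c"
  by (simp add: linear_extension_def linear_sum[OF assms] linear_scale[OF assms])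

lemma linear_extension_cong:
  "(\<And>S. S \<in> Poly_Mapping.keys c \<Longrightarrow> F S = F' S) \<Longrightarrow> linear_extension F c = linear_extension F' c"
  by (simp add: linear_extension_def)

text \<open>
  A formula that is alternating in the vertices may be evaluated on any ordering, not only on the
  chosen one.
\<close>

lemma linear_extension_oriented_simplex:
  assumes ori: "oriented_complex K ori" and vs: "distinct vs" "simplex_vertices K (set vs)"
    and F: "alternating_on (set vs) F"
  shows "linear_extension (\<lambda>S. F (ori S)) (oriented_simplex ori vs) = F vs"
  using alternating_on_ordering_sign[OF F distinct_orientation[OF ori vs(2)]
      set_orientation[OF ori vs(2)] vs(1) refl]
  by (simp add: oriented_simplex_def Let_def linear_extension_single)

lemma oriented_simplex_in_chains:
  assumes "distinct vs" "length vs = Suc k" "simplex_vertices K (set vs)"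
  shows "oriented_simplex ori vs \<in> chains K k"
  using convex_hull_in_simplices[OF assms(3)] distinct_card[OF assms(1)] assms(2)
  by (simp add: oriented_simplex_def chains_def Let_def)

lemma chain_map_eq_linear_extension:
  "chain_map ori f = linear_extension (\<lambda>S. oriented_simplex ori (map f (ori S)))"
  by (simp add: fun_eq_iff chain_map_def linear_extension_def)

lemma boundary_eq_linear_extension:
  assumes "oriented_complex K ori" "c \<in> chains K (Suc k)"
  shows "boundary ori (Suc k) c = linear_extension (\<lambda>S. boundary_sum ori (ori S)) c"
proof -
  have "length (ori S) = Suc (Suc k)" if "S \<in> Poly_Mapping.keys c" for S
    using that assms(2) by (intro orientation_of_simplex(4)[OF assms(1)]) (auto simp: chains_def)
  then show ?thesis
    by (simp add: boundary_def linear_extension_def boundary_sum_def omit_def lessThan_Suc_atMost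
        del: sum.atMost_Suc sum.lessThan_Suc cong: sum.cong)
qed

lemma chain_map_oriented_simplex:
  assumes "oriented_complex K ori" "simplicial_isomorphism K f"
    and "distinct vs" "simplex_vertices K (set vs)"
  shows "chain_map ori f (oriented_simplex ori vs) = oriented_simplex ori (map f vs)"
  unfolding chain_map_eq_linear_extension
proof (rule linear_extension_oriented_simplex[OF assms(1,3,4)])
  have "geometric_complex K" using assms(1) by (simp add: oriented_complex_def)
  then show "alternating_on (set vs) (\<lambda>vs. oriented_simplex ori (map f vs))"
    using assms
    by (intro alternating_on_map alternating_on_oriented_simplex simplex_vertices_image
        simplicial_isomorphism_inj_on)
qed

lemma chain_map_in_chains:
  assumes ori: "oriented_complex K ori" and f: "simplicial_isomorphism K f" and c: "c \<in> chains K k"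
  shows "chain_map ori f c \<in> chains K k"
  unfolding chain_map_eq_linear_extension
proof (rule linear_extension_in_subspace[OF subspace_chains])
  fix S assume "S \<in> Poly_Mapping.keys c"
  then have "S \<in> simplices K k" using c by (auto simp: chains_def)
  note S = orientation_of_simplex[OF ori this]
  have K: "geometric_complex K" using ori by (simp add: oriented_complex_def)
  show "oriented_simplex ori (map f (ori S)) \<in> chains K k"
    using S simplex_vertices_image[OF K f S(2)] simplicial_isomorphism_inj_on[OF K f S(2)]
    by (intro oriented_simplex_in_chains) (simp_all add: distinct_map)
qed

lemma boundary_in_chains:
  assumes ori: "oriented_complex K ori" and c: "c \<in> chains K (Suc k)"
  shows "boundary ori (Suc k) c \<in> chains K k"
  unfolding boundary_eq_linear_extension[OF assms]
proof (rule linear_extension_in_subspace[OF subspace_chains])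
  fix S assume "S \<in> Poly_Mapping.keys c"
  then have "S \<in> simplices K (Suc k)" using c by (auto simp: chains_def)
  note S = orientation_of_simplex[OF ori this]
  show "boundary_sum ori (ori S) \<in> chains K k"
    unfolding boundary_sum_def using S
    by (intro subspace_sum[OF subspace_chains] subspace_scale[OF subspace_chains]
        oriented_simplex_in_chains distinct_omit simplex_vertices_omit[OF ori])
      (simp_all add: length_omit)
qed

text \<open>
  By linearity the identity is checked on the ordering \<open>ori S\<close> of a simplex \<open>S\<close>. There \<open>map f (ori S)\<close>
  need not be the chosen ordering of the image simplex, and neither need the faces of \<open>ori S\<close> be
  listed in their chosen orderings; hence the evaluation of both operators on arbitrary orderings.
\<close>

lemma boundary_chain_map:
  assumes ori: "oriented_complex K ori" and f: "simplicial_isomorphism K f"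
    and c: "c \<in> chains K (Suc k)"
  shows "boundary ori (Suc k) (chain_map ori f c) = chain_map ori f (boundary ori (Suc k) c)"
proof -
  let ?B = "linear_extension (\<lambda>S. boundary_sum ori (ori S))"
  have K: "geometric_complex K" using ori by (simp add: oriented_complex_def)
  have basis: "?B (oriented_simplex ori (map f (ori S))) = chain_map ori f (boundary_sum ori (ori S))"
    if "S \<in> Poly_Mapping.keys c" for S
  proof -
    have "S \<in> simplices K (Suc k)" using that c by (auto simp: chains_def)
    note S = orientation_of_simplex[OF ori this]
    have fS: "distinct (map f (ori S))" "simplex_vertices K (set (map f (ori S)))"
      using S simplex_vertices_image[OF K f S(2)] simplicial_isomorphism_inj_on[OF K f S(2)]
      by (simp_all add: distinct_map)
    have "?B (oriented_simplex ori (map f (ori S))) = boundary_sum ori (map f (ori S))"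
      by (rule linear_extension_oriented_simplex[OF ori fS alternating_on_boundary_sum[OF ori fS(2)]])
    also have "\<dots> = (\<Sum>i<length (ori S). (-1) ^ i *\<^sub>R
        chain_map ori f (oriented_simplex ori (omit i (ori S))))"
      unfolding boundary_sum_def
      by (simp add: omit_map chain_map_oriented_simplex[OF ori f distinct_omit[OF S(1)]
            simplex_vertices_omit[OF ori S(2)]])
    also have "\<dots> = chain_map ori f (boundary_sum ori (ori S))"
      unfolding boundary_sum_def chain_map_eq_linear_extension
      by (simp only: linear_sum[OF linear_linear_extension] linear_scale[OF linear_linear_extension])
    finally show ?thesis .
  qed
  have "boundary ori (Suc k) (chain_map ori f c) = ?B (chain_map ori f c)"
    by (rule boundary_eq_linear_extension[OF ori chain_map_in_chains[OF ori f c]])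
  also have "\<dots> = linear_extension (\<lambda>S. ?B (oriented_simplex ori (map f (ori S)))) c"
    unfolding chain_map_eq_linear_extension
    by (rule linear_linear_extension_comp[OF linear_linear_extension])
  also have "\<dots> = linear_extension (\<lambda>S. chain_map ori f (boundary_sum ori (ori S))) c"
    by (rule linear_extension_cong[OF basis])
  also have "\<dots> = chain_map ori f (?B c)"
    unfolding chain_map_eq_linear_extension
    by (rule linear_linear_extension_comp[OF linear_linear_extension, symmetric])
  also have "?B c = boundary ori (Suc k) c"
    by (rule boundary_eq_linear_extension[OF ori c, symmetric])
  finally show ?thesis .
qed

section \<open>Equivariance of the exterior derivative\<close>

text \<open>
  The boundary operator agrees with a linear map only on chains of the right degree, since its
  formula sums over a fixed number of omitted positions; hence the separate \<open>M\<close> and \<open>L\<close>.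
\<close>

lemma discrete_forms_pullback:
  assumes \<alpha>: "\<alpha> \<in> discrete_forms K k" and L: "linear L"
    and eq: "\<And>c. c \<in> chains K j \<Longrightarrow> M c = L c" and M: "\<And>c. c \<in> chains K j \<Longrightarrow> M c \<in> chains K k"
  shows "(\<lambda>c\<in>chains K j. \<alpha> (M c)) \<in> discrete_forms K j"
proof -
  have L_in: "L c \<in> chains K k" if "c \<in> chains K j" for c
    using M[OF that] eq[OF that] by simp
  show ?thesis
    using \<alpha> L_in unfolding discrete_forms_def
    by (auto simp: eq linear_add[OF L] linear_scale[OF L] subspace_add[OF subspace_chains]
        subspace_scale[OF subspace_chains])
qed

lemma form_rep_in_discrete_forms:
  assumes "oriented_complex K ori" "simplicial_isomorphism K (\<phi> (inv\<^bsub>G\<^esub> g))"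
    and "\<alpha> \<in> discrete_forms K k"
  shows "form_rep K ori G \<phi> k g \<alpha> \<in> discrete_forms K k"
proof -
  have "(\<lambda>c\<in>chains K k. \<alpha> (chain_map ori (\<phi> (inv\<^bsub>G\<^esub> g)) c)) \<in> discrete_forms K k"
    using chain_map_in_chains[OF assms(1,2)] linear_linear_extension
    by (intro discrete_forms_pullback[OF assms(3)]) (auto simp: chain_map_eq_linear_extension)
  with assms(3) show ?thesis by (simp add: form_rep_def)
qed

lemma ext_deriv_in_discrete_forms:
  assumes "oriented_complex K ori" "\<alpha> \<in> discrete_forms K k"
  shows "ext_deriv K ori k \<alpha> \<in> discrete_forms K (k + 1)"
proof -
  have "(\<lambda>c\<in>chains K (Suc k). \<alpha> (boundary ori (Suc k) c)) \<in> discrete_forms K (Suc k)"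
    by (rule discrete_forms_pullback[OF assms(2) linear_linear_extension
          boundary_eq_linear_extension[OF assms(1)] boundary_in_chains[OF assms(1)]])
  with assms(2) show ?thesis by (simp add: ext_deriv_def)
qed

theorem theorem4p1:
  fixes K :: "'a::euclidean_space set set"
    and ori :: "'a set \<Rightarrow> 'a list"
    and G :: "('g, 'b) monoid_scheme"
    and \<phi> :: "'g \<Rightarrow> 'a \<Rightarrow> 'a"
    and n k :: nat
  assumes "oriented_complex K ori"
    and "n_dimensional n K"
    and "group G"
    and "finite (carrier G)"
    and "acts_simplicially G K \<phi>"
  shows "\<forall>g\<in>carrier G.
    compose (discrete_forms K k) (ext_deriv K ori k) (form_rep K ori G \<phi> k g) =
    compose (discrete_forms K k) (form_rep K ori G \<phi> (k + 1) g) (ext_deriv K ori k)"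
proof
  fix g assume g: "g \<in> carrier G"
  let ?f = "\<phi> (inv\<^bsub>G\<^esub> g)"
  have f: "simplicial_isomorphism K ?f"
    using assms(5) group.inv_closed[OF assms(3) g] by (simp add: acts_simplicially_def)
  have "ext_deriv K ori k (form_rep K ori G \<phi> k g \<alpha>) = form_rep K ori G \<phi> (k + 1) g (ext_deriv K ori k \<alpha>)"
    if \<alpha>: "\<alpha> \<in> discrete_forms K k" for \<alpha>
  proof -
    have "ext_deriv K ori k (form_rep K ori G \<phi> k g \<alpha>) =
        (\<lambda>c\<in>chains K (Suc k). form_rep K ori G \<phi> k g \<alpha> (boundary ori (Suc k) c))"
      using form_rep_in_discrete_forms[where \<phi> = \<phi>, OF assms(1) f \<alpha>] by (simp add: ext_deriv_def)
    also have "\<dots> = (\<lambda>c\<in>chains K (Suc k). \<alpha> (chain_map ori ?f (boundary ori (Suc k) c)))"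
      using \<alpha> boundary_in_chains[OF assms(1)] by (intro restrict_ext) (simp add: form_rep_def)
    also have "\<dots> = (\<lambda>c\<in>chains K (Suc k). \<alpha> (boundary ori (Suc k) (chain_map ori ?f c)))"
      by (intro restrict_ext) (simp add: boundary_chain_map[OF assms(1) f])
    also have "\<dots> = (\<lambda>c\<in>chains K (Suc k). ext_deriv K ori k \<alpha> (chain_map ori ?f c))"
      using \<alpha> chain_map_in_chains[OF assms(1) f] by (intro restrict_ext) (simp add: ext_deriv_def)
    also have "\<dots> = form_rep K ori G \<phi> (k + 1) g (ext_deriv K ori k \<alpha>)"
      using ext_deriv_in_discrete_forms[OF assms(1) \<alpha>] by (simp add: form_rep_def)
    finally show ?thesis .
  qed
  then show "compose (discrete_forms K k) (ext_deriv K ori k) (form_rep K ori G \<phi> k g) =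
      compose (discrete_forms K k) (form_rep K ori G \<phi> (k + 1) g) (ext_deriv K ori k)"
    unfolding compose_def by (intro restrict_ext)
qed

end
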